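(* Let $\mathbb{F}$ be a field of odd characteristic $p$, and let $n=\left[\frac{p-2}{2}\right]+2$. Suppose $C\in\mathbb{M}_n(\mathbb{F})$ is a companion matrix with $\mathrm{Tr}(C)=(2n-1)\cdot 1$, such that neither $0$ nor $2$ is an eigenvalue of $C$. Assume $C=E_1+E_2+V$, where $E_1,E_2,V\in\mathbb{M}_n(\mathbb{F})$, $E_1^2=E_1$, $E_2^2=E_2$, and $V$ is nilpotent. Then $V^{\left[\frac{p-2}{2}\right]+1}\neq 0$.
   Context: $\mathbb{M}_n(\mathbb{F})$ is the ring of $n\times n$ matrices over $\mathbb{F}$. The characteristic $p$ is positive (an odd prime). $[x]$ denotes the integer part (floor) of the real number $x$. For an integer $t$, $t\cdot 1$ denotes the corresponding integer multiple of the unity of $\mathbb{F}$; the element $2$ of $\mathbb{F}$ means $2\cdot 1$. A companion matrix in $\mathbb{M}_n(\mathbb{F})$ is a matrix of the form $$C_{c_0,c_1,\ldots,c_{n-1}}=\left(\begin{array}{ccccc} 0 & 0 & \ldots & 0 & -c_0\\ 1 & 0 & \ldots & 0 & -c_1\\ \vdots & \vdots & \cdots & \vdots & \vdots\\ 0 & 0 & \ldots & 1 & -c_{n-1}\end{array}\right),$$ i.e. with entries $1$ on the first subdiagonal, last column $(-c_0,\dots,-c_{n-1})^T$ with $c_0,\dots,c_{n-1}\in\mathbb{F}$, and zeros elsewhere. *)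

theory Defs
  imports Complex_Main "Jordan_Normal_Form.Char_Poly"
begin

definition mat_trace :: "'a::comm_monoid_add mat \<Rightarrow> 'a" where
  "mat_trace A = (\<Sum>i<dim_row A. A $$ (i, i))"

text \<open>Rows and columns are numbered from 0. The last-column case comes first, so that for
  \<open>n = 1\<close> the companion matrix is the \<open>1 \<times> 1\<close> matrix with entry \<open>- c 0\<close>.\<close>
definition companion_mat :: "nat \<Rightarrow> (nat \<Rightarrow> 'a::comm_ring_1) \<Rightarrow> 'a mat" where
  "companion_mat n c =
     mat n n (\<lambda>(i, j). if j = n - 1 then - c i else if i = j + 1 then 1 else 0)"

definition nilpotent_mat :: "'a::semiring_1 mat \<Rightarrow> bool" where
  "nilpotent_mat A \<longleftrightarrow> (\<exists>k::nat. A ^\<^sub>m k = 0\<^sub>m (dim_row A) (dim_row A))"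

end

(*
Since 2n - 1 = p, the companion matrix has trace 0, and V has trace 0, so the ranks r1, r2 of the
idempotents satisfy p | r1 + r2 <= 2n = p + 1.  If r1 + r2 = 0 then C = V is singular, which is
excluded; hence r1 + r2 = 2n - 1, one idempotent is the identity, and the other one, E, fixes a
hyperplane {v. y . v = 0} pointwise.  So V agrees on that hyperplane with the invertible matrix
M = C - 2.  The n - 1 linear conditions y . M^i v = 0 (i < n - 1) have a solution v <> 0, and then
V^(n-1) v = M^(n-1) v <> 0.
*)

theory Submission
  imports Defs
begin

section \<open>The trace, and its vanishing on nilpotent matrices\<close>

lemma mat_trace_add:
  fixes A B :: "'a::comm_monoid_add mat"
  assumes "A \<in> carrier_mat n n" "B \<in> carrier_mat n n"
  shows "mat_trace (A + B) = mat_trace A + mat_trace B"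
  using assms by (simp add: mat_trace_def sum.distrib)

lemma mat_trace_mult_commute:
  fixes A B :: "'a::comm_semiring_0 mat"
  assumes "A \<in> carrier_mat n m" "B \<in> carrier_mat m n"
  shows "mat_trace (A * B) = mat_trace (B * A)"
proof -
  have "mat_trace (A * B) = (\<Sum>i<n. \<Sum>j<m. A $$ (i, j) * B $$ (j, i))"
    using assms by (simp add: mat_trace_def scalar_prod_def atLeast0LessThan)
  also have "\<dots> = (\<Sum>j<m. \<Sum>i<n. B $$ (j, i) * A $$ (i, j))"
    by (subst sum.swap) (simp add: mult.commute)
  also have "\<dots> = mat_trace (B * A)"
    using assms by (simp add: mat_trace_def scalar_prod_def atLeast0LessThan)
  finally show ?thesis .
qed

text \<open>Trades the linear coefficient for a derivative, so that the product rule
  \<open>pderiv_prod\<close> computes linear coefficients of products.\<close>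

lemma poly_pderiv_0: "poly (pderiv q) 0 = coeff q 1"
  by (simp add: poly_0_coeff_0 coeff_pderiv)

lemma coeff_1_prod_linear:
  "coeff (\<Prod>i\<in>S. [:1, a i:]) 1 = (\<Sum>i\<in>S. a i :: 'a::idom)"
  unfolding poly_pderiv_0 [symmetric]
  by (simp add: pderiv_prod poly_sum poly_prod pderiv_pCons)

text \<open>Two factors divisible by X make the product divisible by X^2. In the product rule each
  summand drops only one factor, so one of the two always survives and vanishes at 0.\<close>

lemma coeff_1_prod_eq_0:
  fixes f :: "'b \<Rightarrow> 'a::idom poly"
  assumes "finite S" "i \<in> S" "j \<in> S" "i \<noteq> j" "coeff (f i) 0 = 0" "coeff (f j) 0 = 0"
  shows "coeff (prod f S) 1 = 0"
proof -
  have "(\<Prod>k\<in>S - {a}. poly (f k) 0) = 0" for a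
    using assms by (auto simp: poly_0_coeff_0 prod_zero_iff)
  then show ?thesis
    unfolding poly_pderiv_0 [symmetric]
    by (simp add: pderiv_prod poly_sum poly_prod)
qed

text \<open>A permutation that moves \<open>i\<close> also moves its image, so its Leibniz term
  contains two off-diagonal entries, both multiples of X. Hence only the identity contributes to the
  linear coefficient, through the product of the 1 - a_ii X.\<close>

lemma coeff_1_det_one_minus:
  fixes A :: "'a::idom mat"
  assumes A: "A \<in> carrier_mat n n"
  shows "coeff (det (1\<^sub>m n - [:0, 1:] \<cdot>\<^sub>m map_mat (\<lambda>a. [:a:]) A)) 1 = - mat_trace A"
    (is "coeff (det ?M) 1 = _")
proof -
  let ?P = "{\<pi>. \<pi> permutes {0..<n}}"
  let ?t = "\<lambda>\<pi>. coeff (signof \<pi> * (\<Prod>i = 0..<n. ?M $$ (i, \<pi> i))) 1"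
  have M: "?M \<in> carrier_mat n n"
    using A by auto
  have entry: "?M $$ (i, j) = [:if i = j then 1 else 0, - A $$ (i, j):]" if "i < n" "j < n" for i j
    using A that by (auto simp: one_pCons)
  have "?t \<pi> = 0" if "\<pi> \<in> ?P - {id}" for \<pi>
  proof -
    have perm: "\<pi> permutes {0..<n}" using that by simp
    from that obtain i where i: "\<pi> i \<noteq> i"
      by (auto simp: fun_eq_iff)
    then have "i < n" "\<pi> i < n"
      using perm permutes_not_in [OF perm, of i] permutes_in_image [OF perm, of i] by auto
    moreover have "\<pi> (\<pi> i) \<noteq> \<pi> i"
      using i permutes_inj [OF perm] by (auto simp: inj_eq)
    moreover have "\<pi> (\<pi> i) < n"
      using permutes_in_image [OF perm, of "\<pi> i"] \<open>\<pi> i < n\<close> by auto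
    ultimately have "coeff (\<Prod>i = 0..<n. ?M $$ (i, \<pi> i)) 1 = 0"
      using i by (intro coeff_1_prod_eq_0 [of _ i "\<pi> i"]) (auto simp: entry simp del: index_minus_mat)
    then show ?thesis
      by (cases \<pi> rule: sign_cases) simp_all
  qed
  then have "(\<Sum>\<pi>\<in>?P. ?t \<pi>) = (\<Sum>\<pi>\<in>{id}. ?t \<pi>)"
    by (intro sum.mono_neutral_right) (auto simp: finite_permutations permutes_id)
  also have "\<dots> = coeff (\<Prod>i = 0..<n. [:1, - A $$ (i, i):]) 1"
    by (simp add: entry del: index_minus_mat cong: prod.cong_simp)
  also have "\<dots> = - mat_trace A"
    using A by (subst coeff_1_prod_linear) (simp add: mat_trace_def sum_negf atLeast0LessThan)
  finally show ?thesis
    by (simp only: det_def' [OF M] coeff_sum)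
qed

text \<open>The witness is the sum of the powers of \<open>A\<close> with exponent below
  \<open>k\<close>. When the k-th power vanishes, it is a left inverse of 1 - A.\<close>

lemma geometric_sum_mat:
  fixes A :: "'a::comm_ring_1 mat"
  assumes A: "A \<in> carrier_mat n n"
  shows "\<exists>B \<in> carrier_mat n n. B * (1\<^sub>m n - A) = 1\<^sub>m n - A ^\<^sub>m k"
proof (induction k)
  case 0
  show ?case
    using A by (intro bexI [of _ "0\<^sub>m n n"]) auto
next
  case (Suc k)
  then obtain B where B: "B \<in> carrier_mat n n" "B * (1\<^sub>m n - A) = 1\<^sub>m n - A ^\<^sub>m k"
    by blast
  have Ak: "A ^\<^sub>m k \<in> carrier_mat n n"
    using A by simp
  have "(B + A ^\<^sub>m k) * (1\<^sub>m n - A) = B * (1\<^sub>m n - A) + A ^\<^sub>m k * (1\<^sub>m n - A)"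
    using A B Ak by (intro add_mult_distrib_mat) auto
  also have "A ^\<^sub>m k * (1\<^sub>m n - A) = A ^\<^sub>m k - A ^\<^sub>m Suc k"
    using A Ak by (subst mult_minus_distrib_mat [of _ n n]) auto
  also have "B * (1\<^sub>m n - A) + (A ^\<^sub>m k - A ^\<^sub>m Suc k) = 1\<^sub>m n - A ^\<^sub>m Suc k"
    unfolding B(2) using A Ak by (intro eq_matI) auto
  finally show ?case
    using B(1) Ak by (intro bexI [of _ "B + A ^\<^sub>m k"]) auto
qed

lemma smult_pow_mat:
  fixes A :: "'a::comm_semiring_1 mat"
  assumes A: "A \<in> carrier_mat n n"
  shows "(c \<cdot>\<^sub>m A) ^\<^sub>m k = c ^ k \<cdot>\<^sub>m A ^\<^sub>m k"
proof (induction k)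
  case (Suc k)
  have Ak: "A ^\<^sub>m k \<in> carrier_mat n n"
    using A by simp
  have "(c \<cdot>\<^sub>m A) ^\<^sub>m Suc k = c ^ k \<cdot>\<^sub>m (A ^\<^sub>m k * (c \<cdot>\<^sub>m A))"
    using A Ak Suc mult_smult_assoc_mat [OF Ak, of "c \<cdot>\<^sub>m A" n "c ^ k"] by simp
  also have "A ^\<^sub>m k * (c \<cdot>\<^sub>m A) = c \<cdot>\<^sub>m (A ^\<^sub>m k * A)"
    using A Ak by (intro mult_smult_distrib) auto
  finally show ?case
    using A by (auto simp: ac_simps)
qed (use A in auto)

lemma map_mat_lift_pow:
  fixes A :: "'a::comm_ring_1 mat"
  assumes A: "A \<in> carrier_mat n n"
  shows "map_mat (\<lambda>a. [:a:]) A ^\<^sub>m k = map_mat (\<lambda>a. [:a:]) (A ^\<^sub>m k)"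
proof (induction k)
  case (Suc k)
  then show ?case
    using map_poly_mult(1) [OF pow_carrier_mat [OF A] A] by simp
qed (use A in auto)

lemma mat_trace_nilpotent:
  fixes A :: "'a::field mat"
  assumes A: "A \<in> carrier_mat n n" and nil: "nilpotent_mat A"
  shows "mat_trace A = 0"
proof -
  \<comment> \<open>\<open>1 - X A\<close> is invertible over the polynomial ring, so its determinant, whose linear
    coefficient is minus the trace, is constant.\<close>
  define W where "W = [:0, 1:] \<cdot>\<^sub>m map_mat (\<lambda>a. [:a:]) A"
  obtain k where k: "A ^\<^sub>m k = 0\<^sub>m n n"
    using nil A by (auto simp: nilpotent_mat_def)
  have W: "W \<in> carrier_mat n n"
    using A by (simp add: W_def)
  have "W ^\<^sub>m k = [:0, 1:] ^ k \<cdot>\<^sub>m map_mat (\<lambda>a. [:a:]) (A ^\<^sub>m k)"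
    using A by (simp add: W_def smult_pow_mat [of _ n] map_mat_lift_pow)
  then have Wk: "W ^\<^sub>m k = 0\<^sub>m n n"
    by (auto simp: k)
  obtain B where B: "B \<in> carrier_mat n n" "B * (1\<^sub>m n - W) = 1\<^sub>m n"
    using geometric_sum_mat [OF W, of k] unfolding Wk by force
  have "det B * det (1\<^sub>m n - W) = 1"
    using det_mult [OF B(1) minus_carrier_mat [OF W], of "1\<^sub>m n"] by (simp add: B(2))
  then have "det (1\<^sub>m n - W) dvd 1"
    by (metis dvd_triv_right)
  then have "degree (det (1\<^sub>m n - W)) = 0"
    by (simp add: poly_dvd_1)
  then have "coeff (det (1\<^sub>m n - W)) 1 = 0"
    by (simp add: coeff_eq_0)
  then show ?thesis
    using coeff_1_det_one_minus [OF A] by (simp add: W_def)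
qed

section \<open>Diagonalization and rank of idempotent matrices\<close>

text \<open>Multilinearity of the determinant. Applied to \<open>E + (1 - E)\<close> it yields a basis of row
  eigenvectors of an idempotent \<open>E\<close>.\<close>
lemma det_add_choose_rows:
  fixes A B :: "'a::comm_ring_1 mat"
  assumes A: "A \<in> carrier_mat n n" and B: "B \<in> carrier_mat n n"
    and det: "det (A + B) \<noteq> 0"
  shows "\<exists>S \<subseteq> {..<n}. det (mat\<^sub>r n n (\<lambda>i. if i \<in> S then row A i else row B i)) \<noteq> 0"
proof -
  \<comment> \<open>In \<open>f k S\<close> the choice is already made for the rows below
    \<open>k\<close>, and the remaining rows are still sums. The induction on \<open>k\<close>
    splits one more row at a time.\<close>
  define f where "f k S i = (if i < k then if i \<in> S then row A i else row B i
    else row A i + row B i)" for k S i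
  have f: "f k S i \<in> carrier_vec n" if "i < n" for k S i
    using that A B by (auto simp: f_def)
  have "\<exists>S \<subseteq> {..<k}. det (mat\<^sub>r n n (f k S)) \<noteq> 0" if "k \<le> n" for k
    using that
  proof (induction k)
    case 0
    have "mat\<^sub>r n n (f 0 {}) = A + B"
      using A B by (intro eq_matI) (auto simp: f_def)
    then show ?case
      using det by auto
  next
    case (Suc k)
    then obtain S where S: "S \<subseteq> {..<k}" "det (mat\<^sub>r n n (f k S)) \<noteq> 0"
      by auto
    have "det (mat\<^sub>r n n (\<lambda>i. if i = k then row A i + row B i else f k S i)) =
        det (mat\<^sub>r n n (\<lambda>i. if i = k then row A i else f k S i)) +
        det (mat\<^sub>r n n (\<lambda>i. if i = k then row B i else f k S i))"
      using Suc.prems A B by (intro det_row_add) (auto intro!: f)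
    \<comment> \<open>Since \<open>S\<close> lies below \<open>k\<close>, choosing the row of
      \<open>A\<close> means inserting \<open>k\<close> into \<open>S\<close>, and choosing the row
      of \<open>B\<close> means leaving \<open>S\<close> as it is.\<close>
    moreover have "(\<lambda>i. if i = k then row A i + row B i else f k S i) = f k S"
      and "(\<lambda>i. if i = k then row A i else f k S i) = f (Suc k) (insert k S)"
      and "(\<lambda>i. if i = k then row B i else f k S i) = f (Suc k) S"
      using S(1) by (auto simp: f_def fun_eq_iff less_Suc_eq)
    ultimately have "det (mat\<^sub>r n n (f (Suc k) (insert k S))) \<noteq> 0 \<or>
        det (mat\<^sub>r n n (f (Suc k) S)) \<noteq> 0"
      using S(2) by auto
    moreover have "insert k S \<subseteq> {..<Suc k}" "S \<subseteq> {..<Suc k}"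
      using S(1) by auto
    ultimately show ?case
      by blast
  qed
  then obtain S where S: "S \<subseteq> {..<n}" "det (mat\<^sub>r n n (f n S)) \<noteq> 0"
    by blast
  moreover have "mat\<^sub>r n n (f n S) = mat\<^sub>r n n (\<lambda>i. if i \<in> S then row A i else row B i)"
    by (intro eq_matI) (auto simp: f_def)
  ultimately show ?thesis
    by auto
qed

text \<open>From E E = E and (1 - E) E = 0, the rows of E and of 1 - E are left eigenvectors of E
  for 1 and 0. As these two matrices add up to the identity, n independent rows can be chosen; they
  form R, which satisfies R E = D R with D the 0-1 diagonal matrix of S.\<close>

lemma idempotent_mat_diagonalizable:
  fixes E :: "'a::field mat"
  assumes E: "E \<in> carrier_mat n n" and idem: "E * E = E"
  obtains L R S where "S \<subseteq> {..<n}" "L \<in> carrier_mat n n" "R \<in> carrier_mat n n"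
    "L * R = 1\<^sub>m n" "R * L = 1\<^sub>m n" "E = L * (mat_diag n (\<lambda>i. of_bool (i \<in> S)) * R)"
proof -
  let ?E' = "1\<^sub>m n - E"
  let ?R = "\<lambda>S. mat\<^sub>r n n (\<lambda>i. if i \<in> S then row E i else row ?E' i)"
  have E': "?E' \<in> carrier_mat n n"
    using E by auto
  have "E + ?E' = 1\<^sub>m n"
    using E by (intro eq_matI) auto
  then obtain S where S: "S \<subseteq> {..<n}" "det (?R S) \<noteq> 0"
    using det_add_choose_rows [OF E E'] by auto
  define R where "R = ?R S"
  have R: "R \<in> carrier_mat n n"
    by (intro carrier_matI) (simp_all add: R_def)
  obtain L where L: "L \<in> carrier_mat n n" "L * R = 1\<^sub>m n" "R * L = 1\<^sub>m n"
    using det_non_zero_imp_unit [OF R, of "()"] S(2)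
    by (auto simp: R_def Units_def ring_mat_def)
  have E'E: "?E' * E = 0\<^sub>m n n"
    using E by (subst minus_mult_distrib_mat [of _ n n]) (auto simp: idem)
  have "R * E = mat_diag n (\<lambda>i. of_bool (i \<in> S)) * R"
  proof (rule eq_matI)
    fix i j
    assume "i < dim_row (mat_diag n (\<lambda>i. of_bool (i \<in> S)) * R)"
      "j < dim_col (mat_diag n (\<lambda>i. of_bool (i \<in> S)) * R)"
    then have ij: "i < n" "j < n"
      using R by (auto simp: mat_diag_def)
    have "(R * E) $$ (i, j) = (if i \<in> S then (E * E) $$ (i, j) else (?E' * E) $$ (i, j))"
      using ij E R E' by (simp add: R_def)
    also have "\<dots> = of_bool (i \<in> S) * R $$ (i, j)"
      unfolding idem E'E using ij E by (simp add: R_def)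
    finally show "(R * E) $$ (i, j) = (mat_diag n (\<lambda>i. of_bool (i \<in> S)) * R) $$ (i, j)"
      using ij R by (simp add: mat_diag_mult_left)
  qed (use E R in \<open>auto simp: mat_diag_def\<close>)
  then have "E = L * (mat_diag n (\<lambda>i. of_bool (i \<in> S)) * R)"
    using assoc_mult_mat [OF L(1) R E] left_mult_one_mat [OF E] by (simp add: L(2))
  then show thesis
    using that S(1) L R by blast
qed

text \<open>The number r counts the ones on the diagonal. It has to be a natural number of its own,
  since in positive characteristic the trace determines it only modulo the characteristic. The ranks
  0, n - 1 and n are the ones that the final case analysis meets.\<close>

lemma idempotent_mat_rank:
  fixes E :: "'a::field mat"
  assumes E: "E \<in> carrier_mat n n" and idem: "E * E = E"
  shows "\<exists>r \<le> n. mat_trace E = of_nat r \<and> (r = 0 \<longrightarrow> E = 0\<^sub>m n n) \<and> (r = n \<longrightarrow> E = 1\<^sub>m n) \<and>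
    (Suc r = n \<longrightarrow> (\<exists>y \<in> carrier_vec n. \<forall>v \<in> carrier_vec n. y \<bullet> v = 0 \<longrightarrow> E *\<^sub>v v = v))"
proof -
  obtain L R S where S: "S \<subseteq> {..<n}" and L: "L \<in> carrier_mat n n" and R: "R \<in> carrier_mat n n"
    and LR: "L * R = 1\<^sub>m n" and RL: "R * L = 1\<^sub>m n"
    and E_eq: "E = L * (mat_diag n (\<lambda>i. of_bool (i \<in> S)) * R)"
    using idempotent_mat_diagonalizable [OF E idem] .
  let ?D = "mat_diag n (\<lambda>i. of_bool (i \<in> S)) :: 'a mat"
  have D: "?D \<in> carrier_mat n n"
    by simp
  have finS: "finite S"
    using S finite_subset by blast
  \<comment> \<open>Cyclicity of the trace brings \<open>R\<close> next to \<open>L\<close>, and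
    \<open>R * L\<close> cancels.\<close>
  have "mat_trace E = mat_trace (?D * R * L)"
    unfolding E_eq using L R D by (intro mat_trace_mult_commute [of _ n n]) (auto simp del: mat_diag_dim)
  also have "?D * R * L = ?D"
    using assoc_mult_mat [OF D R L] right_mult_one_mat [OF D] by (simp only: RL)
  also have "mat_trace ?D = of_nat (card S)"
    using S by (simp add: mat_trace_def mat_diag_def of_bool_def sum.If_cases Int_absorb1)
  finally have trace: "mat_trace E = of_nat (card S)" .
  have card: "card S \<le> n"
    using card_mono [OF _ S] by simp
  show ?thesis
  proof (intro exI [of _ "card S"] conjI impI card trace)
    assume "card S = 0"
    then have "?D = 0\<^sub>m n n"
      using finS by (auto simp: mat_diag_def)
    then show "E = 0\<^sub>m n n"
      using L R by (simp add: E_eq)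
  next
    assume "card S = n"
    then have "S = {..<n}"
      using S by (simp add: card_subset_eq)
    then have "?D = 1\<^sub>m n"
      by (auto simp: mat_diag_def)
    then show "E = 1\<^sub>m n"
      using R LR by (simp add: E_eq)
  next
    assume "Suc (card S) = n"
    then have "card ({..<n} - S) = 1"
      using S finS by (simp add: card_Diff_subset)
    then obtain k where k: "{..<n} - S = {k}"
      by (auto simp: card_1_singleton_iff)
    \<comment> \<open>The index \<open>k\<close> marks the only zero on the diagonal. If
      \<open>row R k\<close> annihilates v, then R v has k-th coordinate 0, so D fixes R v and E v =
      L R v = v.\<close>
    have "E *\<^sub>v v = v" if v: "v \<in> carrier_vec n" and 0: "row R k \<bullet> v = 0" for v
    proof -
      have "?D *\<^sub>v (R *\<^sub>v v) = R *\<^sub>v v"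
      proof (rule eq_vecI)
        fix i assume "i < dim_vec (R *\<^sub>v v)"
        then have i: "i < n"
          using R by auto
        have "(?D *\<^sub>v (R *\<^sub>v v)) $ i = (\<Sum>j<n. (if i = j then of_bool (j \<in> S) else 0) * (R *\<^sub>v v) $ j)"
          using i R by (simp add: mat_diag_def scalar_prod_def atLeast0LessThan)
        also have "\<dots> = of_bool (i \<in> S) * (R *\<^sub>v v) $ i"
          using i by (simp add: if_distrib [of "\<lambda>x. x * _"] cong: if_cong)
        also have "\<dots> = (R *\<^sub>v v) $ i"
        proof (cases "i \<in> S")
          case False
          then have "i = k"
            using i k by auto
          then show ?thesis
            using 0 i R by simp
        qed simp
        finally show "(?D *\<^sub>v (R *\<^sub>v v)) $ i = (R *\<^sub>v v) $ i" .
      qed (use R in \<open>auto simp: mat_diag_def\<close>)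
      moreover have "E *\<^sub>v v = L *\<^sub>v (?D *\<^sub>v (R *\<^sub>v v))"
        using assoc_mult_mat_vec [OF L mult_carrier_mat [OF D R] v] assoc_mult_mat_vec [OF D R v]
        by (simp only: E_eq)
      moreover have "L *\<^sub>v (R *\<^sub>v v) = v"
        using v L R LR by (simp flip: assoc_mult_mat_vec [of _ n n _ n])
      ultimately show ?thesis
        by simp
    qed
    then show "\<exists>y \<in> carrier_vec n. \<forall>v \<in> carrier_vec n. y \<bullet> v = 0 \<longrightarrow> E *\<^sub>v v = v"
      using R k by (intro bexI [of _ "row R k"]) auto
  qed
qed

section \<open>Powers of two matrices that agree on a hyperplane\<close>

lemma zero_mat_mult_vec:
  "v \<in> carrier_vec m \<Longrightarrow> 0\<^sub>m n m *\<^sub>v v = (0\<^sub>v n :: 'a::semiring_0 vec)"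
  by (intro eq_vecI) auto

lemma pow_mat_Suc_mult_vec:
  fixes A :: "'a::comm_semiring_1 mat"
  assumes "A \<in> carrier_mat n n" "v \<in> carrier_vec n"
  shows "A ^\<^sub>m Suc k *\<^sub>v v = A ^\<^sub>m k *\<^sub>v (A *\<^sub>v v)"
  using assms by (simp add: assoc_mult_mat_vec [of _ n n _ n])

text \<open>Serves twice: it keeps the final vector of an orbit nonzero, and it shows that an
  injective matrix of positive size is not nilpotent.\<close>

lemma pow_mat_mult_vec_inj:
  fixes A :: "'a::comm_semiring_1 mat"
  assumes "A \<in> carrier_mat n n" "v \<in> carrier_vec n"
    and "\<And>u. u \<in> carrier_vec n \<Longrightarrow> A *\<^sub>v u = 0\<^sub>v n \<Longrightarrow> u = 0\<^sub>v n"
    and "A ^\<^sub>m k *\<^sub>v v = 0\<^sub>v n"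
  shows "v = 0\<^sub>v n"
  using assms(2,4)
proof (induction k arbitrary: v)
  case 0
  then show ?case
    using assms(1) by simp
next
  case (Suc k)
  then have "A *\<^sub>v v = 0\<^sub>v n"
    using assms(1) by (simp only: pow_mat_Suc_mult_vec [OF assms(1)]) auto
  then show ?case
    using assms(3) Suc.prems by simp
qed

text \<open>As long as the orbit of v under A stays in the hyperplane, B takes the same steps.
  Splitting off the first step turns v into A v, hence the induction with v arbitrary.\<close>

lemma pow_mat_mult_vec_cong_hyperplane:
  fixes A B :: "'a::comm_semiring_1 mat"
  assumes A: "A \<in> carrier_mat n n" and B: "B \<in> carrier_mat n n" and "v \<in> carrier_vec n"
    and agree: "\<And>u. u \<in> carrier_vec n \<Longrightarrow> y \<bullet> u = 0 \<Longrightarrow> B *\<^sub>v u = A *\<^sub>v u"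
    and "\<And>i. i < k \<Longrightarrow> y \<bullet> (A ^\<^sub>m i *\<^sub>v v) = 0"
  shows "B ^\<^sub>m k *\<^sub>v v = A ^\<^sub>m k *\<^sub>v v"
  using assms(3,5)
proof (induction k arbitrary: v)
  case 0
  then show ?case
    using A B by simp
next
  case (Suc k)
  have "B *\<^sub>v v = A *\<^sub>v v"
    using Suc.prems(2) [of 0] A Suc.prems(1) agree by simp
  moreover have "B ^\<^sub>m k *\<^sub>v (A *\<^sub>v v) = A ^\<^sub>m k *\<^sub>v (A *\<^sub>v v)"
  proof (rule Suc.IH)
    show "y \<bullet> (A ^\<^sub>m i *\<^sub>v (A *\<^sub>v v)) = 0" if "i < k" for i
      using Suc.prems(2) [of "Suc i"] that pow_mat_Suc_mult_vec [OF A Suc.prems(1)] by simp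
  qed (use A Suc.prems in auto)
  ultimately show ?case
    by (simp only: pow_mat_Suc_mult_vec [OF A Suc.prems(1)] pow_mat_Suc_mult_vec [OF B Suc.prems(1)])
qed

text \<open>Only k = n - 1 linear conditions keep the first k orbit points in the hyperplane, so
  some nonzero v meets them all; then B^k v = A^k v, which is nonzero by injectivity of A.\<close>

lemma pow_mat_neq_0_if_cong_hyperplane:
  fixes A B :: "'a::field mat"
  assumes A: "A \<in> carrier_mat n n" and B: "B \<in> carrier_mat n n" and y: "y \<in> carrier_vec n"
    and inj: "\<And>u. u \<in> carrier_vec n \<Longrightarrow> A *\<^sub>v u = 0\<^sub>v n \<Longrightarrow> u = 0\<^sub>v n"
    and agree: "\<And>u. u \<in> carrier_vec n \<Longrightarrow> y \<bullet> u = 0 \<Longrightarrow> B *\<^sub>v u = A *\<^sub>v u"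
    and n: "n = Suc k"
  shows "B ^\<^sub>m k \<noteq> 0\<^sub>m n n"
proof
  assume Bk: "B ^\<^sub>m k = 0\<^sub>m n n"
  \<comment> \<open>Row i < k represents the functional that sends v to y . A^i v. The zero row at
    \<open>k\<close> pads the conditions to a square matrix, whose determinant vanishes and which
    therefore has a nonzero kernel vector.\<close>
  define K where "K = mat\<^sub>r n n (\<lambda>i. if i = k then 0\<^sub>v n else transpose_mat (A ^\<^sub>m i) *\<^sub>v y)"
  have K: "K \<in> carrier_mat n n"
    by (intro carrier_matI) (simp_all add: K_def)
  have rows: "transpose_mat (A ^\<^sub>m i) *\<^sub>v y \<in> carrier_vec n" for i
    using A y by (intro mult_mat_vec_carrier [of _ n n]) auto
  have "det K = 0"
    unfolding K_def using rows n by (intro det_row_0) auto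
  then obtain v where v: "v \<in> carrier_vec n" "v \<noteq> 0\<^sub>v n" "K *\<^sub>v v = 0\<^sub>v n"
    using det_0_iff_vec_prod_zero_field [OF K] by auto
  have "y \<bullet> (A ^\<^sub>m i *\<^sub>v v) = 0" if "i < k" for i
  proof -
    have "y \<bullet> (A ^\<^sub>m i *\<^sub>v v) = (transpose_mat (A ^\<^sub>m i) *\<^sub>v y) \<bullet> v"
      using A y v by (intro transpose_vec_mult_scalar [symmetric]) auto
    also have "\<dots> = (K *\<^sub>v v) $ i"
      using that n A by (simp add: K_def)
    finally show ?thesis
      using that n by (simp add: v(3))
  qed
  then have "B ^\<^sub>m k *\<^sub>v v = A ^\<^sub>m k *\<^sub>v v"
    using pow_mat_mult_vec_cong_hyperplane [OF A B v(1)] agree by blast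
  then have "A ^\<^sub>m k *\<^sub>v v = 0\<^sub>v n"
    using v(1) by (simp add: Bk zero_mat_mult_vec)
  then show False
    using pow_mat_mult_vec_inj [OF A v(1) inj] v(2) by blast
qed

section \<open>Sums of two idempotents and a nilpotent matrix\<close>

text \<open>Where E u = u, the equation for C gives V u = C u - 2 u. The matrix C - 2, written
  \<open>char_matrix C 2\<close>, is injective because 2 is not an eigenvalue.\<close>

lemma idempotent_plus_one_pow_neq_0:
  fixes C E V :: "'a::field mat"
  assumes E: "E \<in> carrier_mat n n" and V: "V \<in> carrier_mat n n"
    and C: "C = 1\<^sub>m n + E + V" and ev: "\<not> eigenvalue C 2"
    and y: "y \<in> carrier_vec n" "\<forall>v \<in> carrier_vec n. y \<bullet> v = 0 \<longrightarrow> E *\<^sub>v v = v"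
    and n: "n = Suc k"
  shows "V ^\<^sub>m k \<noteq> 0\<^sub>m n n"
proof (rule pow_mat_neq_0_if_cong_hyperplane [OF _ V y(1) _ _ n])
  have C_carrier: "C \<in> carrier_mat n n"
    using E V by (simp add: C)
  let ?M = "char_matrix C 2"
  show "?M \<in> carrier_mat n n"
    using C_carrier by simp
  show "u = 0\<^sub>v n" if "u \<in> carrier_vec n" "?M *\<^sub>v u = 0\<^sub>v n" for u
    using ev that eigenvalue_char_matrix [OF C_carrier] by blast
  show "V *\<^sub>v u = ?M *\<^sub>v u" if u: "u \<in> carrier_vec n" "y \<bullet> u = 0" for u
  proof -
    have "C *\<^sub>v u = u + E *\<^sub>v u + V *\<^sub>v u"
      using E V u by (simp add: C add_mult_distrib_mat_vec [of _ n n])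
    moreover have "?M *\<^sub>v u = C *\<^sub>v u + (- 2) \<cdot>\<^sub>v u"
      using C_carrier u unfolding char_matrix_def
      by (intro eq_vecI) (auto simp: add_scalar_prod_distrib [of _ n])
    moreover have "E *\<^sub>v u = u"
      using y(2) u by blast
    ultimately show ?thesis
      using u V by (intro eq_vecI) auto
  qed
qed

theorem proposition8:
  fixes C E1 E2 V :: "'a::field mat"
    and n p :: nat
  assumes "CHAR('a) = p" and "odd p"
    and "n = nat \<lfloor>(real p - 2) / 2\<rfloor> + 2"
    and "\<exists>c :: nat \<Rightarrow> 'a. C = companion_mat n c"
    and "mat_trace C = of_int (2 * int n - 1)"
    and "\<not> eigenvalue C 0" and "\<not> eigenvalue C 2"
    and "E1 \<in> carrier_mat n n" and "E2 \<in> carrier_mat n n" and "V \<in> carrier_mat n n"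
    and "C = E1 + E2 + V"
    and "E1 * E1 = E1" and "E2 * E2 = E2"
    and "nilpotent_mat V"
  shows "V ^\<^sub>m (nat \<lfloor>(real p - 2) / 2\<rfloor> + 1) \<noteq> 0\<^sub>m n n"
proof -
  note E1 = \<open>E1 \<in> carrier_mat n n\<close> and E2 = \<open>E2 \<in> carrier_mat n n\<close>
    and V = \<open>V \<in> carrier_mat n n\<close> and C = \<open>C = E1 + E2 + V\<close>
  define k where "k = nat \<lfloor>(real p - 2) / 2\<rfloor> + 1"
  have n: "n = Suc k"
    using assms(3) by (simp add: k_def)
  \<comment> \<open>A field has no characteristic 1, so the odd p is at least 3. With p = 2 m + 3
    the floor is m, hence n = m + 2 and 2 n = p + 1.\<close>
  have "p \<noteq> 1"
    using assms(1) by auto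
  then have "\<exists>m. p = 2 * m + 3"
    using \<open>odd p\<close> by presburger
  then obtain m where m: "p = 2 * m + 3" ..
  then have "\<lfloor>(real p - 2) / 2\<rfloor> = int m"
    by (intro floor_unique) auto
  then have p_eq: "p + 1 = 2 * n"
    using m assms(3) by simp
  have C_carrier: "C \<in> carrier_mat n n"
    using E1 E2 V by (simp add: C)
  obtain r1 where r1: "r1 \<le> n" "mat_trace E1 = of_nat r1" "r1 = 0 \<Longrightarrow> E1 = 0\<^sub>m n n"
      "r1 = n \<Longrightarrow> E1 = 1\<^sub>m n"
      "Suc r1 = n \<Longrightarrow> \<exists>y \<in> carrier_vec n. \<forall>v \<in> carrier_vec n. y \<bullet> v = 0 \<longrightarrow> E1 *\<^sub>v v = v"
    using idempotent_mat_rank [OF E1 \<open>E1 * E1 = E1\<close>] by blast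
  obtain r2 where r2: "r2 \<le> n" "mat_trace E2 = of_nat r2" "r2 = 0 \<Longrightarrow> E2 = 0\<^sub>m n n"
      "r2 = n \<Longrightarrow> E2 = 1\<^sub>m n"
      "Suc r2 = n \<Longrightarrow> \<exists>y \<in> carrier_vec n. \<forall>v \<in> carrier_vec n. y \<bullet> v = 0 \<longrightarrow> E2 *\<^sub>v v = v"
    using idempotent_mat_rank [OF E2 \<open>E2 * E2 = E2\<close>] by blast
  have "mat_trace C = of_nat (r1 + r2)"
    using E1 E2 V mat_trace_nilpotent [OF V \<open>nilpotent_mat V\<close>]
    by (simp add: C mat_trace_add [of _ n] r1(2) r2(2))
  \<comment> \<open>The prescribed trace is p times the unity, that is 0; since V has trace 0, the
    two ranks add up to a multiple of p.\<close>
  moreover have "2 * int n - 1 = int p"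
    using p_eq by linarith
  then have "mat_trace C = of_nat CHAR('a)"
    using assms(1,5) by (simp only: of_int_of_nat_eq)
  ultimately have "of_nat (r1 + r2) = (0 :: 'a)"
    by (simp only: of_nat_CHAR)
  then have "p dvd r1 + r2"
    using assms(1) by (simp only: of_nat_eq_0_iff_char_dvd)
  then obtain q where q: "r1 + r2 = p * q"
    by (elim dvdE)
  \<comment> \<open>Otherwise 2 p <= r1 + r2 <= 2 n = p + 1, contrary to p >= 3.\<close>
  have "q < 2"
  proof (rule ccontr)
    assume "\<not> q < 2"
    then have "p * 2 \<le> p * q"
      by (intro mult_le_mono2) simp
    then show False
      using q r1(1) r2(1) p_eq m by linarith
  qed
  \<comment> \<open>If both ranks vanish, then C = V is nilpotent. But C is injective, as 0 is not
    an eigenvalue, so its powers cannot kill the first unit vector.\<close>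
  moreover have "q \<noteq> 0"
  proof
    assume "q = 0"
    then have "C = V"
      using q r1(3) r2(3) V by (simp add: C)
    then obtain j where j: "C ^\<^sub>m j = 0\<^sub>m n n"
      using \<open>nilpotent_mat V\<close> V by (auto simp: nilpotent_mat_def)
    have "u = 0\<^sub>v n" if "u \<in> carrier_vec n" "C *\<^sub>v u = 0\<^sub>v n" for u
    proof -
      have "0 \<cdot>\<^sub>v u = 0\<^sub>v n"
        using that(1) by (intro eq_vecI) auto
      then show ?thesis
        using \<open>\<not> eigenvalue C 0\<close> that C_carrier
        by (force simp: eigenvalue_def eigenvector_def)
    qed
    then have "unit_vec n 0 = (0\<^sub>v n :: 'a vec)"
      by (rule pow_mat_mult_vec_inj [OF C_carrier unit_vec_carrier, of j]) (simp_all add: j zero_mat_mult_vec)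
    then show False
      using n by simp
  qed
  ultimately have "r1 + r2 = p"
    using q by (simp add: less_2_cases_iff)
  \<comment> \<open>Two numbers that are at most n and add up to p = 2 n - 1 must be n and n -
    1.\<close>
  then consider "r1 = n" "Suc r2 = n" | "r2 = n" "Suc r1 = n"
    using r1(1) r2(1) p_eq by linarith
  then have "V ^\<^sub>m k \<noteq> 0\<^sub>m n n"
  proof cases
    case 1
    then show ?thesis
      using r2(5) r1(4) idempotent_plus_one_pow_neq_0 [OF E2 V _ \<open>\<not> eigenvalue C 2\<close> _ _ n] C
      by auto
  next
    case 2
    moreover have "C = E2 + E1 + V"
      using C comm_add_mat [OF E1 E2] by simp
    ultimately show ?thesis
      using r1(5) r2(4) idempotent_plus_one_pow_neq_0 [OF E1 V _ \<open>\<not> eigenvalue C 2\<close> _ _ n]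
      by auto
  qed
  then show ?thesis
    by (simp add: k_def)
qed

end
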